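(* (Soundness) If $\Gamma\vdash p:A$ is derivable in minimal intuitionistic predicate logic (MQC), then in any world $w$ of any IK-CPS model, if $w\Vdash\Gamma$ (i.e. every formula of $\Gamma$ is forced at $w$), then $w\Vdash A$.
   Context: MQC is the natural deduction system with proof terms for the connectives $\wedge,\vee,\Rightarrow,\forall,\exists$ (no $\bot$), with judgements $\Gamma\vdash p:A$ where $\Gamma$ is a context of hypotheses $a:A$, given by the rules: axiom ($(a:A)\in\Gamma$ gives $\Gamma\vdash a:A$); $\wedge$-introduction $(p,q)$ and eliminations $\pi_1 p,\pi_2 p$; $\vee$-introductions $\iota_1 p,\iota_2 p$ and elimination $\mathrm{case}\ p\ \mathrm{of}\ (a_1.q_1 \| a_2.q_2)$ deriving any $C$ from $\Gamma\vdash p:A_1\vee A_2$, $\Gamma,a_1:A_1\vdash q_1:C$, $\Gamma,a_2:A_2\vdash q_2:C$; $\Rightarrow$-introduction $\lambda a.p$ and elimination $p\,q$; $\forall$-introduction $\lambda x.p$ (with $x$ fresh) and elimination $p\,t$ giving $A(t)$; $\exists$-introduction $(t,p)$ from $A(t)$, and elimination $\mathrm{dest}\ p\ \mathrm{as}\ (x,a)\ \mathrm{in}\ q$ deriving $C$ from $\Gamma\vdash p:\exists x.A(x)$ and $\Gamma,a:A(x)\vdash q:C$ with $x$ fresh. An IK-CPS model consists of: a preorder $(K,\le)$ of worlds; a binary relation $w \Vdash_\bot^{C}$ between worlds and formulas ("exploding"); a strong forcing relation $w \Vdash_s X$ for atomic $X$, monotone in $w$; and domains $D(w)$ increasing in $w$.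 Strong forcing is extended simultaneously with forcing $\Vdash$: $w \Vdash A$ iff for every formula $C$ and every $w'\ge w$, if for all $w''\ge w'$ ($w''\Vdash_s A$ implies $w''\Vdash_\bot^{C}$), then $w'\Vdash_\bot^{C}$; $w\Vdash_s A\wedge B$ iff $w\Vdash A$ and $w\Vdash B$; $w\Vdash_s A\vee B$ iff $w\Vdash A$ or $w\Vdash B$; $w\Vdash_s A\Rightarrow B$ iff for all $w'\ge w$, $w'\Vdash A$ implies $w'\Vdash B$; $w\Vdash_s \forall x.A(x)$ iff for all $w'\ge w$ and $t\in D(w')$, $w'\Vdash A(t)$; $w\Vdash_s \exists x.A(x)$ iff $w\Vdash A(t)$ for some $t\in D(w)$. *)

theory Defs
  imports Main
begin

section \<open>First-order language\<close>

text \<open>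
  Individual variables are de Bruijn indices, so formulas are taken up to renaming of bound
  variables. A signature lists the function and predicate symbols together with their arities;
  either component may be empty.
\<close>

record ('f, 'p) signature =
  funs :: "('f \<times> nat) set"
  preds :: "('p \<times> nat) set"

datatype 'f tm = Var nat | Fun 'f "'f tm list"

datatype ('f, 'p) fm =
    Atom 'p "'f tm list"
  | Conj "('f, 'p) fm" "('f, 'p) fm"
  | Disj "('f, 'p) fm" "('f, 'p) fm"
  | Impl "('f, 'p) fm" "('f, 'p) fm"
  | Forall "('f, 'p) fm"
  | Exists "('f, 'p) fm"

primrec wf_tm :: "('f, 'p) signature \<Rightarrow> 'f tm \<Rightarrow> bool" where
  "wf_tm S (Var n) \<longleftrightarrow> True"
| "wf_tm S (Fun f ts) \<longleftrightarrow> (f, length ts) \<in> funs S \<and> list_all (wf_tm S) ts"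

primrec wf_fm :: "('f, 'p) signature \<Rightarrow> ('f, 'p) fm \<Rightarrow> bool" where
  "wf_fm S (Atom P ts) \<longleftrightarrow> (P, length ts) \<in> preds S \<and> list_all (wf_tm S) ts"
| "wf_fm S (Conj A B) \<longleftrightarrow> wf_fm S A \<and> wf_fm S B"
| "wf_fm S (Disj A B) \<longleftrightarrow> wf_fm S A \<and> wf_fm S B"
| "wf_fm S (Impl A B) \<longleftrightarrow> wf_fm S A \<and> wf_fm S B"
| "wf_fm S (Forall A) \<longleftrightarrow> wf_fm S A"
| "wf_fm S (Exists A) \<longleftrightarrow> wf_fm S A"

primrec subst_tm :: "(nat \<Rightarrow> 'f tm) \<Rightarrow> 'f tm \<Rightarrow> 'f tm" where
  "subst_tm \<sigma> (Var n) = \<sigma> n"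
| "subst_tm \<sigma> (Fun f ts) = Fun f (map (subst_tm \<sigma>) ts)"

definition up :: "(nat \<Rightarrow> 'f tm) \<Rightarrow> nat \<Rightarrow> 'f tm" where
  "up \<sigma> = case_nat (Var 0) (\<lambda>n. subst_tm (\<lambda>m. Var (Suc m)) (\<sigma> n))"

primrec subst_fm :: "(nat \<Rightarrow> 'f tm) \<Rightarrow> ('f, 'p) fm \<Rightarrow> ('f, 'p) fm" where
  "subst_fm \<sigma> (Atom P ts) = Atom P (map (subst_tm \<sigma>) ts)"
| "subst_fm \<sigma> (Conj A B) = Conj (subst_fm \<sigma> A) (subst_fm \<sigma> B)"
| "subst_fm \<sigma> (Disj A B) = Disj (subst_fm \<sigma> A) (subst_fm \<sigma> B)"
| "subst_fm \<sigma> (Impl A B) = Impl (subst_fm \<sigma> A) (subst_fm \<sigma> B)"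
| "subst_fm \<sigma> (Forall A) = Forall (subst_fm (up \<sigma>) A)"
| "subst_fm \<sigma> (Exists A) = Exists (subst_fm (up \<sigma>) A)"

text \<open>
  For \<open>A\<close> the body of a quantifier, \<open>inst A t\<close> is \<open>A(t)\<close>. A formula \<open>lift C\<close> is \<open>C\<close> weakened by
  one new variable, which has index 0 and does not occur in \<open>lift C\<close>.
\<close>

definition inst :: "('f, 'p) fm \<Rightarrow> 'f tm \<Rightarrow> ('f, 'p) fm" where
  "inst A t = subst_fm (case_nat t Var) A"

definition lift :: "('f, 'p) fm \<Rightarrow> ('f, 'p) fm" where
  "lift C = subst_fm (\<lambda>n. Var (Suc n)) C"


section \<open>The natural deduction system MQC\<close>

text \<open>
  Hypothesis variables are de Bruijn indices as well, independent of those of the individual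
  variables: \<open>Lam\<close> binds one hypothesis, \<open>Case\<close> one in each branch, \<open>LamT\<close> one individual, and
  \<open>Dest p q\<close> binds one individual and one hypothesis in \<open>q\<close>.
\<close>

datatype 'f pf =
    Hyp nat
  | PairP "'f pf" "'f pf"
  | Proj1 "'f pf"
  | Proj2 "'f pf"
  | Inj1 "'f pf"
  | Inj2 "'f pf"
  | Case "'f pf" "'f pf" "'f pf"
  | Lam "'f pf"
  | App "'f pf" "'f pf"
  | LamT "'f pf"
  | AppT "'f pf" "'f tm"
  | PairT "'f tm" "'f pf"
  | Dest "'f pf" "'f pf"

text \<open>
  In \<open>AllI\<close> and \<open>ExE\<close>, lifting the context and the conclusion expresses the freshness of the
  bound variable. The well-formedness premises are those needed for every judgement derivable
  over \<open>S\<close> to consist of formulas over \<open>S\<close>, and for the terms in proof terms to be terms over \<open>S\<close>.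
\<close>

inductive mqc :: "('f, 'p) signature \<Rightarrow> ('f, 'p) fm list \<Rightarrow> 'f pf \<Rightarrow> ('f, 'p) fm \<Rightarrow> bool"
  for S :: "('f, 'p) signature" where
  Ax: "\<forall>B \<in> set \<Gamma>. wf_fm S B \<Longrightarrow> i < length \<Gamma> \<Longrightarrow> mqc S \<Gamma> (Hyp i) (\<Gamma> ! i)"
| AndI: "mqc S \<Gamma> p A \<Longrightarrow> mqc S \<Gamma> q B \<Longrightarrow> mqc S \<Gamma> (PairP p q) (Conj A B)"
| AndE1: "mqc S \<Gamma> p (Conj A B) \<Longrightarrow> mqc S \<Gamma> (Proj1 p) A"
| AndE2: "mqc S \<Gamma> p (Conj A B) \<Longrightarrow> mqc S \<Gamma> (Proj2 p) B"
| OrI1: "mqc S \<Gamma> p A \<Longrightarrow> wf_fm S B \<Longrightarrow> mqc S \<Gamma> (Inj1 p) (Disj A B)"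
| OrI2: "mqc S \<Gamma> p B \<Longrightarrow> wf_fm S A \<Longrightarrow> mqc S \<Gamma> (Inj2 p) (Disj A B)"
| OrE: "mqc S \<Gamma> p (Disj A B) \<Longrightarrow> mqc S (A # \<Gamma>) q C \<Longrightarrow> mqc S (B # \<Gamma>) r C \<Longrightarrow>
    mqc S \<Gamma> (Case p q r) C"
| ImpI: "mqc S (A # \<Gamma>) p B \<Longrightarrow> mqc S \<Gamma> (Lam p) (Impl A B)"
| ImpE: "mqc S \<Gamma> p (Impl A B) \<Longrightarrow> mqc S \<Gamma> q A \<Longrightarrow> mqc S \<Gamma> (App p q) B"
| AllI: "mqc S (map lift \<Gamma>) p A \<Longrightarrow> mqc S \<Gamma> (LamT p) (Forall A)"
| AllE: "mqc S \<Gamma> p (Forall A) \<Longrightarrow> wf_tm S t \<Longrightarrow> mqc S \<Gamma> (AppT p t) (inst A t)"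
| ExI: "mqc S \<Gamma> p (inst A t) \<Longrightarrow> wf_tm S t \<Longrightarrow> mqc S \<Gamma> (PairT t p) (Exists A)"
| ExE: "mqc S \<Gamma> p (Exists A) \<Longrightarrow> mqc S (A # map lift \<Gamma>) q (lift C) \<Longrightarrow>
    mqc S \<Gamma> (Dest p q) C"


section \<open>IK-CPS models\<close>

text \<open>
  A pair \<open>(w, w')\<close> is in \<open>le M\<close> if \<open>w \<le> w'\<close>. In \<open>satom M w P ds\<close> the arguments are elements of
  the domain, so this is strong forcing of an atomic formula with parameters. Since the language
  may have function symbols, a model also interprets them, by operations on each domain that
  agree along the order; over a signature without function symbols these conditions are vacuous.
  Formulas are mere labels in \<open>expl M\<close>.
\<close>

record ('w, 'd, 'f, 'p) model =
  worlds :: "'w set"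
  le :: "('w \<times> 'w) set"
  expl :: "'w \<Rightarrow> ('f, 'p) fm \<Rightarrow> bool"
  satom :: "'w \<Rightarrow> 'p \<Rightarrow> 'd list \<Rightarrow> bool"
  domain :: "'w \<Rightarrow> 'd set"
  fint :: "'w \<Rightarrow> 'f \<Rightarrow> 'd list \<Rightarrow> 'd"

definition ik_cps :: "('f, 'p) signature \<Rightarrow> ('w, 'd, 'f, 'p) model \<Rightarrow> bool" where
  "ik_cps S M \<longleftrightarrow>
    preorder_on (worlds M) (le M) \<and>
    (\<forall>w w'. (w, w') \<in> le M \<longrightarrow> domain M w \<subseteq> domain M w') \<and>
    (\<forall>w w' P ds. (w, w') \<in> le M \<longrightarrow> (P, length ds) \<in> preds S \<longrightarrow> set ds \<subseteq> domain M w \<longrightarrow>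
      satom M w P ds \<longrightarrow> satom M w' P ds) \<and>
    (\<forall>w f ds. w \<in> worlds M \<longrightarrow> (f, length ds) \<in> funs S \<longrightarrow> set ds \<subseteq> domain M w \<longrightarrow>
      fint M w f ds \<in> domain M w) \<and>
    (\<forall>w w' f ds. (w, w') \<in> le M \<longrightarrow> (f, length ds) \<in> funs S \<longrightarrow> set ds \<subseteq> domain M w \<longrightarrow>
      fint M w' f ds = fint M w f ds)"

primrec eval :: "('w, 'd, 'f, 'p) model \<Rightarrow> 'w \<Rightarrow> (nat \<Rightarrow> 'd) \<Rightarrow> 'f tm \<Rightarrow> 'd" where
  "eval M w \<rho> (Var n) = \<rho> n"
| "eval M w \<rho> (Fun f ts) = fint M w f (map (eval M w \<rho>) ts)"

text \<open>
  A formula together with a valuation \<open>\<rho>\<close> of its free variables stands for the formula with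
  parameters from the domain; \<open>case_nat d \<rho>\<close> maps index 0, the variable just released from its
  quantifier, to \<open>d\<close>. At a world \<open>w\<close> only valuations into \<open>domain M w\<close> are meaningful. Worlds
  with an empty domain are allowed and have none: there even closed instances of the derivable
  entailment from \<open>Forall A\<close> to \<open>Exists A\<close> may fail.
\<close>

function forces :: "('f, 'p) signature \<Rightarrow> ('w, 'd, 'f, 'p) model \<Rightarrow>
    'w \<Rightarrow> (nat \<Rightarrow> 'd) \<Rightarrow> ('f, 'p) fm \<Rightarrow> bool"
  and sforces :: "('f, 'p) signature \<Rightarrow> ('w, 'd, 'f, 'p) model \<Rightarrow>
    'w \<Rightarrow> (nat \<Rightarrow> 'd) \<Rightarrow> ('f, 'p) fm \<Rightarrow> bool" where
  "forces S M w \<rho> A \<longleftrightarrow>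
    (\<forall>C w'. wf_fm S C \<longrightarrow> (w, w') \<in> le M \<longrightarrow>
      (\<forall>w''. (w', w'') \<in> le M \<longrightarrow> sforces S M w'' \<rho> A \<longrightarrow> expl M w'' C) \<longrightarrow> expl M w' C)"
| "sforces S M w \<rho> (Atom P ts) \<longleftrightarrow> satom M w P (map (eval M w \<rho>) ts)"
| "sforces S M w \<rho> (Conj A B) \<longleftrightarrow> forces S M w \<rho> A \<and> forces S M w \<rho> B"
| "sforces S M w \<rho> (Disj A B) \<longleftrightarrow> forces S M w \<rho> A \<or> forces S M w \<rho> B"
| "sforces S M w \<rho> (Impl A B) \<longleftrightarrow>
    (\<forall>w'. (w, w') \<in> le M \<longrightarrow> forces S M w' \<rho> A \<longrightarrow> forces S M w' \<rho> B)"
| "sforces S M w \<rho> (Forall A) \<longleftrightarrow>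
    (\<forall>w' d. (w, w') \<in> le M \<longrightarrow> d \<in> domain M w' \<longrightarrow> forces S M w' (case_nat d \<rho>) A)"
| "sforces S M w \<rho> (Exists A) \<longleftrightarrow> (\<exists>d \<in> domain M w. forces S M w (case_nat d \<rho>) A)"
  by pat_completeness auto
termination
  by (relation "measure (case_sum (\<lambda>(S, M, w, \<rho>, A). 2 * size A + 1)
    (\<lambda>(S, M, w, \<rho>, A). 2 * size A))") auto

end

theory Submission
  imports Defs
begin

text \<open>
  Forcing is a continuation monad over strong forcing. The introduction rules use its unit and the
  elimination rules its bind; bind needs no relation between the formula being eliminated and the
  conclusion, because the label \<open>C\<close> in the definition of forcing is arbitrary. The unit needs
  strong forcing to be monotone, but only for compound formulas, so no well-formedness of the
  formulas has to be tracked along the derivation.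
\<close>

text \<open>This equation matches every formula, so rewriting with it would dissolve forcing
  everywhere. The equations for \<open>sforces\<close> remain simp rules and fire only on a
  connective.\<close>

declare forces.simps [simp del]

context
  fixes S :: "('f, 'p) signature" and M :: "('w, 'd, 'f, 'p) model"
  assumes model: "ik_cps S M"
begin

lemma le_refl: "w \<in> worlds M \<Longrightarrow> (w, w) \<in> le M"
  using model by (auto simp: ik_cps_def preorder_on_def refl_on_def)

lemma le_trans: "(u, v) \<in> le M \<Longrightarrow> (v, w) \<in> le M \<Longrightarrow> (u, w) \<in> le M"
  using model by (auto simp: ik_cps_def preorder_on_def dest: transD)

lemma le_worlds:
  assumes "(w, w') \<in> le M"
  shows "w \<in> worlds M" "w' \<in> worlds M"
  using model assms by (auto simp: ik_cps_def preorder_on_def)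

lemma domain_mono: "(w, w') \<in> le M \<Longrightarrow> d \<in> domain M w \<Longrightarrow> d \<in> domain M w'"
  using model by (auto simp: ik_cps_def)

lemma eval_in_domain:
  assumes "w \<in> worlds M" "\<forall>n. \<rho> n \<in> domain M w" "wf_tm S t"
  shows "eval M w \<rho> t \<in> domain M w"
  using assms(3)
proof (induction t)
  case (Fun f ts)
  then have "set (map (eval M w \<rho>) ts) \<subseteq> domain M w"
    by (auto simp: list_all_iff)
  then show ?case
    using Fun.prems assms(1) model by (simp add: ik_cps_def)
qed (simp add: assms)

text \<open>Interpretations of a function symbol agree along the order only on arguments from the
  smaller domain, so the induction needs \<open>eval_in_domain\<close> for the subterms.\<close>

lemma eval_mono:
  assumes "(w, w') \<in> le M" "\<forall>n. \<rho> n \<in> domain M w" "wf_tm S t"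
  shows "eval M w' \<rho> t = eval M w \<rho> t"
  using assms(3)
proof (induction t)
  case (Fun f ts)
  have "set (map (eval M w \<rho>) ts) \<subseteq> domain M w"
    using Fun.prems eval_in_domain assms(2) le_worlds(1)[OF assms(1)] by (auto simp: list_all_iff)
  then have "fint M w' f (map (eval M w \<rho>) ts) = fint M w f (map (eval M w \<rho>) ts)"
    using Fun.prems assms(1) model by (simp add: ik_cps_def)
  moreover have "map (eval M w' \<rho>) ts = map (eval M w \<rho>) ts"
    using Fun by (auto simp: list_all_iff)
  ultimately show ?case
    by (simp only: eval.simps)
qed simp

lemma eval_subst: "eval M w \<rho> (subst_tm \<sigma> t) = eval M w (\<lambda>n. eval M w \<rho> (\<sigma> n)) t"
  by (induction t) (auto cong: map_cong simp: comp_def)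

lemma eval_up:
  "eval M w (case_nat d \<rho>) (up \<sigma> n) = case_nat d (\<lambda>m. eval M w \<rho> (\<sigma> m)) n"
  by (simp add: up_def eval_subst split: nat.split)

text \<open>Monotonicity is built into the quantifier over later worlds, so transitivity suffices
  and no induction on A is required.\<close>

lemma forces_mono:
  assumes "(w, w') \<in> le M" "forces S M w \<rho> A"
  shows "forces S M w' \<rho> A"
  using assms le_trans unfolding forces.simps[of S M _ \<rho> A] by blast

text \<open>Reflexivity lets a continuation given at a later world be applied at that world itself.
  Assuming strong forcing at all later worlds leaves its monotonicity to each introduction rule,
  where it follows from \<open>forces_mono\<close>, \<open>domain_mono\<close> or
  \<open>le_trans\<close>.\<close>

lemma forces_unit:
  assumes "\<And>w'. (w, w') \<in> le M \<Longrightarrow> sforces S M w' \<rho> A"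
  shows "forces S M w \<rho> A"
  unfolding forces.simps[of S M _ \<rho> A] using assms le_worlds(2) le_refl by blast

lemma forces_bind:
  assumes "forces S M w \<rho> A"
    and "\<And>w'. (w, w') \<in> le M \<Longrightarrow> sforces S M w' \<rho> A \<Longrightarrow> forces S M w' \<rho>' B"
  shows "forces S M w \<rho>' B"
  unfolding forces.simps[of S M w \<rho>' B]
proof (intro allI impI)
  fix C w'
  assume C: "wf_fm S C" and w': "(w, w') \<in> le M"
    and k: "\<forall>w''. (w', w'') \<in> le M \<longrightarrow> sforces S M w'' \<rho>' B \<longrightarrow> expl M w'' C"
  \<comment> \<open>This turns the continuation \<open>k\<close> for B into one for A with the same
    label: where A is strongly forced, B is forced, and \<open>k\<close> restricted to the worlds
    above makes that world explode.\<close>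
  have "expl M w'' C" if w'': "(w', w'') \<in> le M" and s: "sforces S M w'' \<rho> A" for w''
  proof -
    have "forces S M w'' \<rho>' B"
      using assms(2) le_trans[OF w' w''] s by blast
    then show ?thesis
      unfolding forces.simps[of S M w'' \<rho>' B]
      using C k le_trans[OF w''] le_refl[OF le_worlds(2)[OF w'']] by blast
  qed
  then show "expl M w' C"
    using assms(1) C w' unfolding forces.simps[of S M w \<rho> A] by blast
qed

lemma forces_cong:
  assumes "\<And>w'. (w, w') \<in> le M \<Longrightarrow> sforces S M w' \<rho> A = sforces S M w' \<rho>' B"
  shows "forces S M w \<rho> A = forces S M w \<rho>' B"
proof -
  have "sforces S M w'' \<rho> A = sforces S M w'' \<rho>' B" if "(w, w') \<in> le M" "(w', w'') \<in> le M" for w' w''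
    using assms le_trans that by blast
  then show ?thesis
    unfolding forces.simps[of S M w] by blast
qed

text \<open>Evaluation depends on the world and the connectives inspect later worlds, so each
  substituted term must keep one value all along the order. Structural induction runs on strong
  forcing; \<open>forces_cong\<close> carries the induction hypotheses over to the forced
  subformulas.\<close>

lemma sforces_subst:
  assumes "w \<in> worlds M" "\<forall>w' n. (w, w') \<in> le M \<longrightarrow> eval M w' \<rho> (\<sigma> n) = \<rho>' n"
  shows "sforces S M w \<rho> (subst_fm \<sigma> A) = sforces S M w \<rho>' A"
  using assms
proof (induction A arbitrary: w \<rho> \<rho>' \<sigma>)
  case (Atom P ts)
  then have "(\<lambda>n. eval M w \<rho> (\<sigma> n)) = \<rho>'"
    using le_refl by blast
  then show ?case
    by (simp add: comp_def eval_subst)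
next
  case (Conj A B)
  have "forces S M w \<rho> (subst_fm \<sigma> A) = forces S M w \<rho>' A"
    by (rule forces_cong, rule Conj.IH(1)) (use Conj.prems le_trans le_worlds(2) in blast)+
  moreover have "forces S M w \<rho> (subst_fm \<sigma> B) = forces S M w \<rho>' B"
    by (rule forces_cong, rule Conj.IH(2)) (use Conj.prems le_trans le_worlds(2) in blast)+
  ultimately show ?case by simp
next
  case (Disj A B)
  have "forces S M w \<rho> (subst_fm \<sigma> A) = forces S M w \<rho>' A"
    by (rule forces_cong, rule Disj.IH(1)) (use Disj.prems le_trans le_worlds(2) in blast)+
  moreover have "forces S M w \<rho> (subst_fm \<sigma> B) = forces S M w \<rho>' B"
    by (rule forces_cong, rule Disj.IH(2)) (use Disj.prems le_trans le_worlds(2) in blast)+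
  ultimately show ?case by simp
next
  case (Impl A B)
  have "forces S M w' \<rho> (subst_fm \<sigma> A) = forces S M w' \<rho>' A" if w': "(w, w') \<in> le M" for w'
    by (rule forces_cong, rule Impl.IH(1))
      (use Impl.prems le_trans[OF w'] le_trans le_worlds(2) in blast)+
  moreover have "forces S M w' \<rho> (subst_fm \<sigma> B) = forces S M w' \<rho>' B" if w': "(w, w') \<in> le M" for w'
    by (rule forces_cong, rule Impl.IH(2))
      (use Impl.prems le_trans[OF w'] le_trans le_worlds(2) in blast)+
  ultimately show ?case by simp
next
  case (Forall A)
  have "forces S M w' (case_nat d \<rho>) (subst_fm (up \<sigma>) A) = forces S M w' (case_nat d \<rho>') A"
    if w': "(w, w') \<in> le M" for w' d
  proof (rule forces_cong, rule Forall.IH)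
    fix v assume v: "(w', v) \<in> le M"
    then show "v \<in> worlds M" by (rule le_worlds)
    show "\<forall>v' n. (v, v') \<in> le M \<longrightarrow>
        eval M v' (case_nat d \<rho>) (up \<sigma> n) = case_nat d \<rho>' n"
      \<comment> \<open>By \<open>eval_up\<close>, index 0 has value \<open>d\<close> on both sides.
        A successor index falls under the assumption on \<sigma>, which applies because
        \<open>v'\<close> lies above \<open>w\<close>.\<close>
      using Forall.prems le_trans[OF le_trans[OF w' v]] by (simp add: eval_up split: nat.split)
  qed
  then show ?case by simp
next
  case (Exists A)
  have "forces S M w (case_nat d \<rho>) (subst_fm (up \<sigma>) A) = forces S M w (case_nat d \<rho>') A" for d
  proof (rule forces_cong, rule Exists.IH)
    fix v assume v: "(w, v) \<in> le M"
    then show "v \<in> worlds M" by (rule le_worlds)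
    show "\<forall>v' n. (v, v') \<in> le M \<longrightarrow>
        eval M v' (case_nat d \<rho>) (up \<sigma> n) = case_nat d \<rho>' n"
      using Exists.prems le_trans[OF v] by (simp add: eval_up split: nat.split)
  qed
  then show ?case by simp
qed

lemma forces_subst:
  assumes "\<And>w' n. (w, w') \<in> le M \<Longrightarrow> eval M w' \<rho> (\<sigma> n) = \<rho>' n"
  shows "forces S M w \<rho> (subst_fm \<sigma> A) = forces S M w \<rho>' A"
  by (rule forces_cong, rule sforces_subst) (use assms le_trans le_worlds(2) in blast)+

text \<open>Semantic form of freshness: index 0 does not occur in \<open>lift A\<close>, so the
  value \<open>d\<close> is never consulted.\<close>

lemma forces_lift: "forces S M w (case_nat d \<rho>) (lift A) = forces S M w \<rho> A"
  unfolding lift_def by (rule forces_subst) simp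

text \<open>The valuation on the right fixes the value of \<open>t\<close> at \<open>w\<close>;
  \<open>eval_mono\<close> ensures that \<open>t\<close> still has this value at every later
  world.\<close>

lemma forces_inst:
  assumes "\<forall>n. \<rho> n \<in> domain M w" "wf_tm S t"
  shows "forces S M w \<rho> (inst A t) = forces S M w (case_nat (eval M w \<rho> t) \<rho>) A"
  unfolding inst_def
  by (rule forces_subst) (simp add: assms eval_mono split: nat.split)

text \<open>World and valuation vary in the induction, because premises are used at later worlds
  and, under a quantifier, with a further domain element at index 0.\<close>

lemma mqc_sound:
  assumes "mqc S \<Gamma> p A" "w \<in> worlds M" "\<forall>n. \<rho> n \<in> domain M w"
    "\<forall>B \<in> set \<Gamma>. forces S M w \<rho> B"
  shows "forces S M w \<rho> A"
  using assms
proof (induction arbitrary: w \<rho> rule: mqc.induct)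
  case (Ax \<Gamma> i)
  then show ?case by simp
next
  case (AndI \<Gamma> p A q B)
  then show ?case
    by (intro forces_unit) (auto intro: forces_mono)
next
  case (AndE1 \<Gamma> p A B)
  then have "forces S M w \<rho> (Conj A B)" by blast
  \<comment> \<open>A strongly forced conjunction has forced components by definition, which is just
    what the bind asks for.\<close>
  then show ?case by (rule forces_bind) simp
next
  case (AndE2 \<Gamma> p A B)
  then have "forces S M w \<rho> (Conj A B)" by blast
  then show ?case by (rule forces_bind) simp
next
  case (OrI1 \<Gamma> p A B)
  then show ?case
    by (intro forces_unit) (auto intro: forces_mono)
next
  case (OrI2 \<Gamma> p B A)
  then show ?case
    by (intro forces_unit) (auto intro: forces_mono)
next
  case (OrE \<Gamma> p A B q C r)
  then have "forces S M w \<rho> (Disj A B)" by blast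
  then show ?case
  proof (rule forces_bind)
    fix w' assume w': "(w, w') \<in> le M" and s: "sforces S M w' \<rho> (Disj A B)"
    have "w' \<in> worlds M" "\<forall>n. \<rho> n \<in> domain M w'" "\<forall>B \<in> set \<Gamma>. forces S M w' \<rho> B"
      using OrE.prems w' le_worlds(2) domain_mono forces_mono by blast+
    then show "forces S M w' \<rho> C"
      using s OrE.IH(2,3)[of w' \<rho>] by auto
  qed
next
  case (ImpI A \<Gamma> p B)
  have "forces S M w' \<rho> B" if w': "(w, w') \<in> le M" and A: "forces S M w' \<rho> A" for w'
  proof (rule ImpI.IH)
    show "w' \<in> worlds M" "\<forall>n. \<rho> n \<in> domain M w'"
      using ImpI.prems w' le_worlds(2) domain_mono by blast+
    show "\<forall>B \<in> set (A # \<Gamma>). forces S M w' \<rho> B"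
      using ImpI.prems w' A forces_mono by auto
  qed
  then show ?case
    by (intro forces_unit) (simp, blast intro: le_trans)
next
  case (ImpE \<Gamma> p A B q)
  then have "forces S M w \<rho> (Impl A B)" and A: "forces S M w \<rho> A" by blast+
  then show ?case
    \<comment> \<open>At a world strongly forcing the implication, A is available by monotonicity,
      and reflexivity allows the implication to be applied right there.\<close>
    by (elim forces_bind) (use A forces_mono le_refl le_worlds(2) in auto)
next
  case (AllI \<Gamma> p A)
  have "forces S M w' (case_nat d \<rho>) A" if w': "(w, w') \<in> le M" and d: "d \<in> domain M w'" for w' d
  proof (rule AllI.IH)
    show "w' \<in> worlds M" using w' by (rule le_worlds)
    show "\<forall>n. (case_nat d \<rho>) n \<in> domain M w'"
      using AllI.prems w' d domain_mono by (auto split: nat.split)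
    show "\<forall>B \<in> set (map lift \<Gamma>). forces S M w' (case_nat d \<rho>) B"
      using AllI.prems w' forces_mono by (auto simp: forces_lift)
  qed
  then show ?case
    by (intro forces_unit) (simp, blast intro: le_trans)
next
  case (AllE \<Gamma> p A t)
  then have "forces S M w \<rho> (Forall A)" by blast
  then show ?case
  proof (rule forces_bind)
    fix w' assume w': "(w, w') \<in> le M" and s: "sforces S M w' \<rho> (Forall A)"
    have "w' \<in> worlds M" "\<forall>n. \<rho> n \<in> domain M w'"
      using AllE.prems w' le_worlds(2) domain_mono by blast+
    then show "forces S M w' \<rho> (inst A t)"
      \<comment> \<open>The universal formula is instantiated at \<open>w'\<close> itself with the
        value of \<open>t\<close> there.\<close>
      using s AllE.hyps by (simp add: forces_inst eval_in_domain le_refl)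
  qed
next
  case (ExI \<Gamma> p A t)
  \<comment> \<open>The value of \<open>t\<close> at \<open>w\<close> is the witness at all later
    worlds too, since domains grow.\<close>
  then have "forces S M w (case_nat (eval M w \<rho> t) \<rho>) A" "eval M w \<rho> t \<in> domain M w"
    by (simp_all add: forces_inst eval_in_domain)
  then show ?case
    by (intro forces_unit) (auto intro: forces_mono domain_mono)
next
  case (ExE \<Gamma> p A q C)
  then have "forces S M w \<rho> (Exists A)" by blast
  then show ?case
  proof (rule forces_bind)
    fix w' assume w': "(w, w') \<in> le M" and "sforces S M w' \<rho> (Exists A)"
    then obtain d where d: "d \<in> domain M w'" and A: "forces S M w' (case_nat d \<rho>) A"
      by auto
    \<comment> \<open>The witness \<open>d\<close> exists only at \<open>w'\<close>; concluding
      \<open>lift C\<close> allows \<open>forces_lift\<close> to discard it afterwards.\<close>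
    have "forces S M w' (case_nat d \<rho>) (lift C)"
    proof (rule ExE.IH(2))
      show "w' \<in> worlds M" using w' by (rule le_worlds)
      show "\<forall>n. (case_nat d \<rho>) n \<in> domain M w'"
        using ExE.prems w' d domain_mono by (auto split: nat.split)
      show "\<forall>B \<in> set (A # map lift \<Gamma>). forces S M w' (case_nat d \<rho>) B"
        using ExE.prems w' A forces_mono by (auto simp: forces_lift)
    qed
    then show "forces S M w' \<rho> C" by (simp add: forces_lift)
  qed
qed

end

theorem theorem9:
  fixes S :: "('f, 'p) signature"
    and M :: "('w, 'd, 'f, 'p) model"
    and \<Gamma> :: "('f, 'p) fm list"
    and p :: "'f pf"
    and A :: "('f, 'p) fm"
    and w :: 'w
    and \<rho> :: "nat \<Rightarrow> 'd"
  assumes "mqc S \<Gamma> p A"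
    and "ik_cps S M"
    and "w \<in> worlds M"
    and "\<forall>n. \<rho> n \<in> domain M w"
    and "\<forall>B \<in> set \<Gamma>. forces S M w \<rho> B"
  shows "forces S M w \<rho> A"
  using assms(2,1,3-) by (rule mqc_sound)

end
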